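(* Let $H$ be a duo monoid. The following conditions are equivalent: (a) $H$ is strongly Archimedean. (b) Every non-trivial divisor-closed subsemigroup of $\mathfrak{I}(H)$ contains the set $\mathfrak{P}(H)$ of principal ideals of $H$.
   Context: Monoids are written multiplicatively. For subsets $X,Y$ of $H$, $XY:=\{xy : x\in X,\ y\in Y\}$, and braces of singletons are omitted in such products (e.g. $HaH = H\{a\}H$). A monoid $H$ is duo if $aH=Ha$ for every $a\in H$; and strongly Archimedean if, for every $a\in H$, there is an integer $k\ge 1$ such that $HaH$ contains every product $b_1\cdots b_k$ of $k$ non-units $b_1,\dots,b_k\in H$. An ideal of $H$ is a non-empty set $I\subseteq H$ with $IH\subseteq I$ and $HI\subseteq I$. The ideals of $H$ form a monoid $\mathfrak{I}(H)$ under setwise multiplication, with identity $H$. A principal ideal is a set of the form $HxH$ with $x\in H$ (in a duo monoid, $HxH=xH$, and the principal ideals form a subsemigroup $\mathfrak{P}(H)$ of $\mathfrak{I}(H)$). For a monoid $M$ and $x,y\in M$, $x$ divides $y$ in $M$ (written $x\mid_M y$) if $y\in MxM$. A (non-empty) subsemigroup $T$ of $M$ is divisor-closed if $x\mid_M y$ and $y\in T$ imply $x\in T$ (such a $T$ necessarily contains $1_M$). A subsemigroup of $M$ containing $1_M$ is trivial if it equals $\{1_M\}$; thus a divisor-closed subsemigroup of $\mathfrak{I}(H)$ is trivial if it equals $\{H\}$. *)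

theory Defs
  imports "HOL-Algebra.Coset"
begin

locale duo_monoid = monoid H for H (structure) +
  assumes duo: "a \<in> carrier H \<Longrightarrow> a <# carrier H = carrier H #> a"

definition princ_ideal :: "('a, 'b) monoid_scheme \<Rightarrow> 'a \<Rightarrow> 'a set"
  where "princ_ideal H a = carrier H <#>\<^bsub>H\<^esub> {a} <#>\<^bsub>H\<^esub> carrier H"

text \<open>A product of \<open>k\<close> non-units is represented by the list of its factors, since the order
  of the factors matters.\<close>

definition strongly_Archimedean :: "('a, 'b) monoid_scheme \<Rightarrow> bool"
  where "strongly_Archimedean H \<longleftrightarrow>
    (\<forall>a \<in> carrier H. \<exists>k::nat. k \<ge> 1 \<and>
      (\<forall>bs. length bs = k \<and> set bs \<subseteq> carrier H - Units H \<longrightarrow>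
        foldr (\<otimes>\<^bsub>H\<^esub>) bs \<one>\<^bsub>H\<^esub> \<in> princ_ideal H a))"

definition monoid_ideal :: "('a, 'b) monoid_scheme \<Rightarrow> 'a set \<Rightarrow> bool"
  where "monoid_ideal H I \<longleftrightarrow> I \<noteq> {} \<and> I \<subseteq> carrier H \<and>
    I <#>\<^bsub>H\<^esub> carrier H \<subseteq> I \<and> carrier H <#>\<^bsub>H\<^esub> I \<subseteq> I"

definition ideal_monoid :: "('a, 'b) monoid_scheme \<Rightarrow> 'a set monoid"
  where "ideal_monoid H =
    \<lparr>carrier = {I. monoid_ideal H I}, mult = (<#>\<^bsub>H\<^esub>), one = carrier H\<rparr>"

definition princ_ideals :: "('a, 'b) monoid_scheme \<Rightarrow> 'a set set"
  where "princ_ideals H = princ_ideal H ` carrier H"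

text \<open>Divisibility is two-sided here (\<open>y \<in> M x M\<close>), unlike the one-sided relation
  of \<open>HOL-Algebra.Divisibility\<close>.\<close>

definition divides_in :: "('a, 'b) monoid_scheme \<Rightarrow> 'a \<Rightarrow> 'a \<Rightarrow> bool"
  where "divides_in M x y \<longleftrightarrow> y \<in> carrier M <#>\<^bsub>M\<^esub> {x} <#>\<^bsub>M\<^esub> carrier M"

definition subsemigroup :: "('a, 'b) monoid_scheme \<Rightarrow> 'a set \<Rightarrow> bool"
  where "subsemigroup M T \<longleftrightarrow> T \<noteq> {} \<and> T \<subseteq> carrier M \<and> T <#>\<^bsub>M\<^esub> T \<subseteq> T"

definition divisor_closed :: "('a, 'b) monoid_scheme \<Rightarrow> 'a set \<Rightarrow> bool"
  where "divisor_closed M T \<longleftrightarrow>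
    (\<forall>x \<in> carrier M. \<forall>y \<in> carrier M. divides_in M x y \<and> y \<in> T \<longrightarrow> x \<in> T)"

lemma set_mult_assoc_monoid:
  assumes "monoid H" "A \<subseteq> carrier H" "B \<subseteq> carrier H" "C \<subseteq> carrier H"
  shows "A <#>\<^bsub>H\<^esub> B <#>\<^bsub>H\<^esub> C = A <#>\<^bsub>H\<^esub> (B <#>\<^bsub>H\<^esub> C)"
proof -
  have *: "x \<otimes>\<^bsub>H\<^esub> y \<otimes>\<^bsub>H\<^esub> z = x \<otimes>\<^bsub>H\<^esub> (y \<otimes>\<^bsub>H\<^esub> z)" if "x \<in> A" "y \<in> B" "z \<in> C" for x y z
    using assms that by (blast intro: monoid.m_assoc)
  show ?thesis
    unfolding set_mult_def using * by auto
qed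

lemma monoid_ideal_set_mult:
  assumes H: "monoid H" and I: "monoid_ideal H I" and J: "monoid_ideal H J"
  shows "monoid_ideal H (I <#>\<^bsub>H\<^esub> J)"
proof -
  let ?C = "carrier H"
  have sub: "I \<subseteq> ?C" "J \<subseteq> ?C" and ne: "I \<noteq> {}" "J \<noteq> {}"
    and abs: "?C <#>\<^bsub>H\<^esub> I \<subseteq> I" "J <#>\<^bsub>H\<^esub> ?C \<subseteq> J"
    using I J by (auto simp: monoid_ideal_def)
  have "I <#>\<^bsub>H\<^esub> J <#>\<^bsub>H\<^esub> ?C \<subseteq> I <#>\<^bsub>H\<^esub> J"
    using set_mult_assoc_monoid[OF H sub(1,2) subset_refl] abs(2) mono_set_mult by blast
  moreover have "?C <#>\<^bsub>H\<^esub> (I <#>\<^bsub>H\<^esub> J) \<subseteq> I <#>\<^bsub>H\<^esub> J"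
    using set_mult_assoc_monoid[OF H subset_refl sub] abs(1) mono_set_mult by blast
  moreover have "I <#>\<^bsub>H\<^esub> J \<noteq> {}"
    using ne by (auto simp: set_mult_def)
  ultimately show ?thesis
    using monoid.set_mult_closed[OF H sub] by (simp add: monoid_ideal_def)
qed

lemma monoid_ideal_monoid:
  assumes "monoid H"
  shows "monoid (ideal_monoid H)"
proof -
  interpret monoid H by fact
  have "monoid_ideal H (carrier H)"
    using one_closed by (auto simp: monoid_ideal_def set_mult_def)
  moreover have "carrier H <#>\<^bsub>H\<^esub> I = I" "I <#>\<^bsub>H\<^esub> carrier H = I" if "monoid_ideal H I" for I
  proof -
    have I: "I \<subseteq> carrier H" and abs: "I <#>\<^bsub>H\<^esub> carrier H \<subseteq> I" "carrier H <#>\<^bsub>H\<^esub> I \<subseteq> I"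
      using that by (auto simp: monoid_ideal_def)
    have "x \<in> carrier H <#>\<^bsub>H\<^esub> I" "x \<in> I <#>\<^bsub>H\<^esub> carrier H" if "x \<in> I" for x
    proof -
      have "\<one>\<^bsub>H\<^esub> \<otimes>\<^bsub>H\<^esub> x = x" "x \<otimes>\<^bsub>H\<^esub> \<one>\<^bsub>H\<^esub> = x"
        using that I by auto
      then show "x \<in> carrier H <#>\<^bsub>H\<^esub> I" "x \<in> I <#>\<^bsub>H\<^esub> carrier H"
        using that one_closed unfolding set_mult_def by force+
    qed
    with abs show "carrier H <#>\<^bsub>H\<^esub> I = I" "I <#>\<^bsub>H\<^esub> carrier H = I"
      by blast+
  qed
  moreover have "A <#>\<^bsub>H\<^esub> B <#>\<^bsub>H\<^esub> C = A <#>\<^bsub>H\<^esub> (B <#>\<^bsub>H\<^esub> C)"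
    if "monoid_ideal H A" "monoid_ideal H B" "monoid_ideal H C" for A B C
    using that set_mult_assoc_monoid[OF assms] by (simp add: monoid_ideal_def)
  ultimately show ?thesis
    using monoid_ideal_set_mult[OF assms]
    by (intro monoidI) (auto simp: ideal_monoid_def)
qed

end

theory Submission
  imports Defs
begin

text \<open>If \<open>H\<close> is strongly Archimedean and \<open>I\<close> is a proper ideal in \<open>T\<close>, then \<open>I\<close> consists of
  non-units, so some power \<open>I\<^sup>k\<close> is contained in \<open>aH\<close>. As \<open>H\<close> is duo, containment in a principal
  ideal is divisibility: \<open>I\<^sup>k = (aH)J\<close> with \<open>J = {x. ax \<in> I\<^sup>k}\<close>. Hence \<open>aH \<in> T\<close>.
  Conversely, the set \<open>N\<close> of non-units, if not empty, is a proper ideal, and the ideals that contain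
  some power of \<open>N\<close> form a non-trivial divisor-closed subsemigroup; that \<open>aH\<close> belongs to it is the
  strong Archimedean property at \<open>a\<close>.\<close>

section \<open>Ideals, their powers and divisibility in an arbitrary monoid\<close>

lemma monoid_ideal_mult_closed:
  assumes "monoid_ideal H I"
  shows "x \<in> I \<Longrightarrow> h \<in> carrier H \<Longrightarrow> x \<otimes>\<^bsub>H\<^esub> h \<in> I"
    and "x \<in> I \<Longrightarrow> h \<in> carrier H \<Longrightarrow> h \<otimes>\<^bsub>H\<^esub> x \<in> I"
  using assms unfolding monoid_ideal_def set_mult_def by blast+

lemma ideal_monoid_simps [simp]:
  "carrier (ideal_monoid H) = {I. monoid_ideal H I}"
  "I \<otimes>\<^bsub>ideal_monoid H\<^esub> J = I <#>\<^bsub>H\<^esub> J"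
  "\<one>\<^bsub>ideal_monoid H\<^esub> = carrier H"
  by (simp_all add: ideal_monoid_def)

lemma divides_in_ideal_monoid_iff:
  "divides_in (ideal_monoid H) I J \<longleftrightarrow>
    (\<exists>A B. monoid_ideal H A \<and> monoid_ideal H B \<and> J = A <#>\<^bsub>H\<^esub> I <#>\<^bsub>H\<^esub> B)"
  by (auto simp: divides_in_def set_mult_def[of "ideal_monoid H"])

context monoid
begin

lemma monoid_ideal_carrier: "monoid_ideal G (carrier G)"
  using monoid.one_closed[OF monoid_ideal_monoid[OF monoid_axioms]] by simp

lemma monoid_ideal_carrier_mult:
  assumes "monoid_ideal G I"
  shows "carrier G <#> I = I" and "I <#> carrier G = I"
  using assms monoid.l_one[OF monoid_ideal_monoid[OF monoid_axioms], of I]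
    monoid.r_one[OF monoid_ideal_monoid[OF monoid_axioms], of I] by simp_all

lemma monoid_ideal_nat_pow:
  "monoid_ideal G I \<Longrightarrow> monoid_ideal G (I [^]\<^bsub>ideal_monoid G\<^esub> (n::nat))"
  using monoid.nat_pow_closed[OF monoid_ideal_monoid[OF monoid_axioms], of I n] by simp

text \<open>An ideal absorbs the cofactors on both sides. This makes any family of ideals that is
  closed under larger ideals divisor-closed.\<close>

lemma monoid_ideal_divides_imp_superset:
  assumes "monoid_ideal G I" "divides_in (ideal_monoid G) I J"
  shows "J \<subseteq> I"
proof -
  obtain A B where "monoid_ideal G A" "monoid_ideal G B" and J: "J = A <#> I <#> B"
    using assms(2) by (auto simp: divides_in_ideal_monoid_iff)
  then have "A \<subseteq> carrier G" "B \<subseteq> carrier G"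
    by (auto simp: monoid_ideal_def)
  then show ?thesis
    using monoid_ideal_mult_closed[OF assms(1)] unfolding J set_mult_def by blast
qed

lemma monoid_ideal_princ_ideal:
  assumes "a \<in> carrier G"
  shows "monoid_ideal G (princ_ideal G a)"
  unfolding monoid_ideal_def
proof (intro conjI)
  show "princ_ideal G a \<noteq> {}"
    using assms by (auto simp: princ_ideal_def set_mult_def)
  show "princ_ideal G a \<subseteq> carrier G"
    using assms by (auto simp: princ_ideal_def set_mult_def)
  show "princ_ideal G a <#> carrier G \<subseteq> princ_ideal G a"
    using assms by (fastforce simp: princ_ideal_def set_mult_def m_assoc)
  show "carrier G <#> princ_ideal G a \<subseteq> princ_ideal G a"
  proof -
    have "h \<otimes> (x \<otimes> a \<otimes> y) = (h \<otimes> x) \<otimes> a \<otimes> y"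
      if "h \<in> carrier G" "x \<in> carrier G" "y \<in> carrier G" for h x y
      using that assms by (simp add: m_assoc)
    then show ?thesis
      unfolding princ_ideal_def set_mult_def by fastforce
  qed
qed

text \<open>A unit in \<open>I\<close> would put \<open>\<one>\<close> into \<open>I\<close>, and
  absorption would then give the whole monoid.\<close>

lemma monoid_ideal_proper_non_units:
  assumes "monoid_ideal G I" "I \<noteq> carrier G"
  shows "I \<subseteq> carrier G - Units G"
proof -
  have I: "I \<subseteq> carrier G"
    using assms(1) by (simp add: monoid_ideal_def)
  have "x \<notin> Units G" if "x \<in> I" for x
  proof
    assume "x \<in> Units G"
    then have "\<one> \<in> I"
      using monoid_ideal_mult_closed(2)[OF assms(1) that, of "inv x"] by (simp add: Units_l_inv)
    then have "carrier G \<subseteq> I"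
      using monoid_ideal_mult_closed(1)[OF assms(1)] by fastforce
    then show False
      using I assms(2) by blast
  qed
  then show ?thesis
    using I by blast
qed

text \<open>The exponent is positive because the zeroth power is all of \<open>G\<close> rather than \<open>{\<one>}\<close>.\<close>

lemma ideal_pow_eq_products:
  assumes I: "monoid_ideal G I"
  shows "I [^]\<^bsub>ideal_monoid G\<^esub> (Suc n) =
    {foldr (\<otimes>) bs \<one> |bs. length bs = Suc n \<and> set bs \<subseteq> I}"
proof (induction n)
  case 0
  have sub: "I \<subseteq> carrier G"
    using I by (simp add: monoid_ideal_def)
  have "I [^]\<^bsub>ideal_monoid G\<^esub> (Suc 0) = I"
    using monoid_ideal_carrier_mult[OF I] by simp
  also have "\<dots> = {foldr (\<otimes>) bs \<one> |bs. length bs = Suc 0 \<and> set bs \<subseteq> I}"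
    using sub by (force simp: length_Suc_conv)
  finally show ?case .
next
  case (Suc n)
  \<comment> \<open>The new factor is split off on the left, because \<open>foldr\<close> puts the
    head of the list there.\<close>
  have "I [^]\<^bsub>ideal_monoid G\<^esub> (Suc (Suc n)) = I <#> I [^]\<^bsub>ideal_monoid G\<^esub> (Suc n)"
    using monoid.nat_pow_Suc2[OF monoid_ideal_monoid[OF monoid_axioms], of I "Suc n"] I by simp
  also have "\<dots> = {b \<otimes> foldr (\<otimes>) bs \<one> |b bs. b \<in> I \<and> length bs = Suc n \<and> set bs \<subseteq> I}"
    unfolding Suc.IH set_mult_def by blast
  also have "\<dots> = {foldr (\<otimes>) bs \<one> |bs. length bs = Suc (Suc n) \<and> set bs \<subseteq> I}"
    (is "?L = ?R")
  proof
    show "?L \<subseteq> ?R"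
    proof
      fix x assume "x \<in> ?L"
      then obtain b bs where "x = b \<otimes> foldr (\<otimes>) bs \<one>" "b \<in> I" "length bs = Suc n" "set bs \<subseteq> I"
        by blast
      then show "x \<in> ?R"
        by (intro CollectI exI[of _ "b # bs"]) simp
    qed
    show "?R \<subseteq> ?L"
    proof
      fix x assume "x \<in> ?R"
      then obtain cs where cs: "x = foldr (\<otimes>) cs \<one>" "length cs = Suc (Suc n)" "set cs \<subseteq> I"
        by blast
      then obtain b bs where "cs = b # bs"
        by (cases cs) auto
      with cs have "x = b \<otimes> foldr (\<otimes>) bs \<one>" "b \<in> I" "length bs = Suc n" "set bs \<subseteq> I"
        by simp_all
      then show "x \<in> ?L"
        by blast
    qed
  qed
  finally show ?case .
qed

text \<open>Brings the definition into the shape of \<open>ideal_pow_eq_products\<close>: when the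
  non-units form an ideal \<open>N\<close>, it says that each principal ideal contains a positive
  power of \<open>N\<close>.\<close>

lemma strongly_Archimedean_iff:
  "strongly_Archimedean G \<longleftrightarrow> (\<forall>a \<in> carrier G. \<exists>n.
    {foldr (\<otimes>) bs \<one> |bs. length bs = Suc n \<and> set bs \<subseteq> carrier G - Units G} \<subseteq> princ_ideal G a)"
proof -
  have "(\<exists>k\<ge>1. P k) \<longleftrightarrow> (\<exists>n. P (Suc n))" for P :: "nat \<Rightarrow> bool"
    by (metis One_nat_def Suc_le_D le_add1 plus_1_eq_Suc)
  moreover have "{f bs |bs. Q bs} \<subseteq> A \<longleftrightarrow> (\<forall>bs. Q bs \<longrightarrow> f bs \<in> A)" for f :: "'a list \<Rightarrow> 'a" and Q A
    by blast
  ultimately show ?thesis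
    unfolding strongly_Archimedean_def by simp
qed

text \<open>Products stay in \<open>T\<close> because exponents add up, and divisors stay in
  \<open>T\<close> because a divisor of an ideal contains it.\<close>

lemma divisor_closed_pow_superset:
  assumes N: "monoid_ideal G N"
  defines "T \<equiv> {I. monoid_ideal G I \<and> (\<exists>n::nat. N [^]\<^bsub>ideal_monoid G\<^esub> (Suc n) \<subseteq> I)}"
  shows "subsemigroup (ideal_monoid G) T" and "divisor_closed (ideal_monoid G) T" and "N \<in> T"
proof -
  interpret M: monoid "ideal_monoid G"
    by (rule monoid_ideal_monoid[OF monoid_axioms])
  have "N [^]\<^bsub>ideal_monoid G\<^esub> (Suc 0) = N"
    using monoid_ideal_carrier_mult[OF N] by simp
  then show "N \<in> T"
    using N unfolding T_def by blast
  have "I <#> J \<in> T" if "I \<in> T" "J \<in> T" for I J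
  proof -
    obtain m n :: nat where mn: "N [^]\<^bsub>ideal_monoid G\<^esub> (Suc m) \<subseteq> I" "N [^]\<^bsub>ideal_monoid G\<^esub> (Suc n) \<subseteq> J"
      using \<open>I \<in> T\<close> \<open>J \<in> T\<close> unfolding T_def by blast
    \<comment> \<open>The exponent is \<open>Suc m + Suc n\<close>, written as a successor so that
      \<open>Suc m + n\<close> is the witness for membership in \<open>T\<close>.\<close>
    have "N [^]\<^bsub>ideal_monoid G\<^esub> (Suc (Suc m + n)) =
        N [^]\<^bsub>ideal_monoid G\<^esub> (Suc m) <#> N [^]\<^bsub>ideal_monoid G\<^esub> (Suc n)"
      using M.nat_pow_mult[of N "Suc m" "Suc n"] N by simp
    also have "\<dots> \<subseteq> I <#> J"
      using mn by (rule mono_set_mult)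
    finally show ?thesis
      using that monoid_ideal_set_mult[OF monoid_axioms] unfolding T_def by blast
  qed
  then show "subsemigroup (ideal_monoid G) T"
    using \<open>N \<in> T\<close>
    by (auto simp: subsemigroup_def set_mult_def[of "ideal_monoid G"]) (simp add: T_def)
  show "divisor_closed (ideal_monoid G) T"
    using monoid_ideal_divides_imp_superset unfolding divisor_closed_def T_def by fastforce
qed

end

section \<open>Units and principal ideals in a duo monoid\<close>

context duo_monoid
begin

lemma princ_ideal_eq:
  assumes "a \<in> carrier H"
  shows "princ_ideal H a = a <# carrier H"
proof -
  have "princ_ideal H a = (a <# carrier H) <#> carrier H"
    using duo[OF assms] by (simp add: princ_ideal_def r_coset_eq_set_mult)
  also have "\<dots> = {a} <#> (carrier H <#> carrier H)"
    using assms set_mult_assoc_monoid[OF monoid_axioms, of "{a}" "carrier H" "carrier H"]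
    by (simp add: l_coset_eq_set_mult)
  finally show ?thesis
    using monoid_ideal_carrier_mult(1)[OF monoid_ideal_carrier] by (simp add: l_coset_eq_set_mult)
qed

text \<open>An inverse of \<open>x \<otimes> y\<close> yields a right inverse of \<open>x\<close>
  and a left inverse of \<open>y\<close>. By the duo property, \<open>\<one>\<close> lies in
  \<open>xH = Hx\<close> and in \<open>Hy = yH\<close>, which supplies the inverses on the other
  side.\<close>

lemma Units_if_mult_Units:
  assumes "x \<in> carrier H" "y \<in> carrier H" "x \<otimes> y \<in> Units H"
  shows "x \<in> Units H" and "y \<in> Units H"
proof -
  let ?u = "inv (x \<otimes> y)"
  have u: "?u \<in> carrier H" "x \<otimes> y \<otimes> ?u = \<one>" "?u \<otimes> (x \<otimes> y) = \<one>"
    using assms by simp_all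
  have "y \<otimes> ?u \<in> carrier H" and "?u \<otimes> x \<in> carrier H"
    using u assms by simp_all
  have r: "x \<otimes> (y \<otimes> ?u) = \<one>" and l: "(?u \<otimes> x) \<otimes> y = \<one>"
    using u assms by (simp_all add: m_assoc[symmetric] del: Units_r_inv Units_l_inv)
  have "\<one> \<in> x <# carrier H" "\<one> \<in> carrier H #> y"
    using r l \<open>y \<otimes> ?u \<in> carrier H\<close> \<open>?u \<otimes> x \<in> carrier H\<close>
    unfolding l_coset_def r_coset_def by force+
  then have "\<one> \<in> carrier H #> x" "\<one> \<in> y <# carrier H"
    using duo assms by simp_all
  then obtain z w where "z \<in> carrier H" "z \<otimes> x = \<one>" "w \<in> carrier H" "y \<otimes> w = \<one>"
    unfolding l_coset_def r_coset_def by force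
  \<comment> \<open>A left inverse \<open>b\<close> and a right inverse \<open>d\<close> of
    \<open>c\<close> coincide.\<close>
  moreover have "c \<in> Units H"
    if "b \<in> carrier H" "c \<in> carrier H" "d \<in> carrier H" "b \<otimes> c = \<one>" "c \<otimes> d = \<one>" for b c d
    using inv_unique[of b c d] that unfolding Units_def by blast
  ultimately show "x \<in> Units H" "y \<in> Units H"
    using r l \<open>y \<otimes> ?u \<in> carrier H\<close> \<open>?u \<otimes> x \<in> carrier H\<close> assms(1,2) by blast+
qed

text \<open>Absorption is the contrapositive of \<open>Units_if_mult_Units\<close>; in a general
  monoid a product of non-units can be a unit.\<close>

lemma monoid_ideal_non_units:
  assumes "carrier H - Units H \<noteq> {}"
  shows "monoid_ideal H (carrier H - Units H)"
  using assms unfolding monoid_ideal_def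
  by (auto simp: set_mult_def dest: Units_if_mult_Units)

text \<open>The converse of \<open>monoid_ideal_divides_imp_superset\<close> when the divisor is
  principal and the monoid is duo.\<close>

lemma princ_ideal_divides_if_superset:
  assumes a: "a \<in> carrier H" and K: "monoid_ideal H K" and sub: "K \<subseteq> princ_ideal H a"
  shows "divides_in (ideal_monoid H) (princ_ideal H a) K"
proof -
  \<comment> \<open>The largest subset with \<open>aJ \<subseteq> K\<close>; equality holds because
    every element of \<open>K\<close> has the form \<open>a \<otimes> x\<close>.\<close>
  define J where "J = {x \<in> carrier H. a \<otimes> x \<in> K}"
  have K_eq: "K = {a} <#> J"
    using sub unfolding princ_ideal_eq[OF a] J_def l_coset_def set_mult_def by auto
  have "x \<otimes> h \<in> J" if "x \<in> J" "h \<in> carrier H" for x h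
    using that a monoid_ideal_mult_closed(1)[OF K, of "a \<otimes> x" h] by (simp add: J_def m_assoc)
  moreover have "h \<otimes> x \<in> J" if "x \<in> J" "h \<in> carrier H" for x h
  proof -
    \<comment> \<open>For absorption on the left, \<open>h\<close> stands between \<open>a\<close>
      and \<open>x\<close>; the duo property moves it past \<open>a\<close> as some
      \<open>h'\<close>, which \<open>K\<close> absorbs.\<close>
    have "a \<otimes> h \<in> carrier H #> a"
      using that(2) duo[OF a] unfolding l_coset_def by blast
    then obtain h' where h': "h' \<in> carrier H" "a \<otimes> h = h' \<otimes> a"
      unfolding r_coset_def by blast
    then have "a \<otimes> (h \<otimes> x) = h' \<otimes> (a \<otimes> x)"
      using that a by (simp add: J_def flip: m_assoc)
    then show ?thesis
      using that h'(1) monoid_ideal_mult_closed(2)[OF K] by (simp add: J_def)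
  qed
  moreover have "J \<noteq> {}"
    using K K_eq by (auto simp: monoid_ideal_def set_mult_def)
  ultimately have J: "monoid_ideal H J"
    unfolding monoid_ideal_def set_mult_def by (auto simp: J_def)
  \<comment> \<open>Divisibility asks for cofactors on both sides: the identity
    \<open>carrier H\<close> on the left, \<open>J\<close> on the right.\<close>
  have "carrier H <#> princ_ideal H a <#> J = ({a} <#> carrier H) <#> J"
    using monoid_ideal_carrier_mult(1)[OF monoid_ideal_princ_ideal[OF a]]
    by (simp add: princ_ideal_eq[OF a] l_coset_eq_set_mult)
  also have "\<dots> = {a} <#> (carrier H <#> J)"
    using a J by (intro set_mult_assoc_monoid monoid_axioms) (auto simp: monoid_ideal_def)
  also have "\<dots> = K"
    using monoid_ideal_carrier_mult(1)[OF J] K_eq by simp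
  finally show ?thesis
    using monoid_ideal_carrier J unfolding divides_in_ideal_monoid_iff by blast
qed

section \<open>The two implications\<close>

lemma princ_ideals_subset_if_strongly_Archimedean:
  assumes arch: "strongly_Archimedean H"
    and sg: "subsemigroup (ideal_monoid H) T"
    and dc: "divisor_closed (ideal_monoid H) T"
    and nontriv: "T \<noteq> {carrier H}"
  shows "princ_ideals H \<subseteq> T"
proof -
  \<comment> \<open>\<open>T\<close> is non-empty, so being different from
    \<open>{carrier H}\<close> forces a proper ideal into it.\<close>
  obtain I where I: "I \<in> T" "monoid_ideal H I" "I \<noteq> carrier H"
    using sg nontriv unfolding subsemigroup_def by auto
  have T_mult: "A <#> B \<in> T" if "A \<in> T" "B \<in> T" for A B
    using sg that by (auto simp: subsemigroup_def set_mult_def[of "ideal_monoid H"])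
  have pow: "I [^]\<^bsub>ideal_monoid H\<^esub> (Suc n) \<in> T" for n
  proof (induction n)
    case 0
    then show ?case
      using I(1) monoid_ideal_carrier_mult[OF I(2)] by simp
  next
    case (Suc n)
    then show ?case
      using T_mult[OF _ I(1)] by simp
  qed
  have "princ_ideal H a \<in> T" if a: "a \<in> carrier H" for a
  proof -
    obtain n where n: "{foldr (\<otimes>) bs \<one> |bs. length bs = Suc n \<and> set bs \<subseteq> carrier H - Units H}
        \<subseteq> princ_ideal H a"
      using arch a unfolding strongly_Archimedean_iff by blast
    \<comment> \<open>Elements of this power are products of \<open>Suc n\<close> elements of
      \<open>I\<close>, all of them non-units.\<close>
    have "I [^]\<^bsub>ideal_monoid H\<^esub> (Suc n) \<subseteq> princ_ideal H a"
      using n monoid_ideal_proper_non_units[OF I(2,3)]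
      unfolding ideal_pow_eq_products[OF I(2)] by blast
    then have "divides_in (ideal_monoid H) (princ_ideal H a) (I [^]\<^bsub>ideal_monoid H\<^esub> (Suc n))"
      by (intro princ_ideal_divides_if_superset a monoid_ideal_nat_pow I(2))
    then show ?thesis
      using dc pow monoid_ideal_princ_ideal[OF a] monoid_ideal_nat_pow[OF I(2)]
      unfolding divisor_closed_def ideal_monoid_simps by blast
  qed
  then show ?thesis
    by (auto simp: princ_ideals_def)
qed

lemma strongly_Archimedean_if_princ_ideals_subset:
  assumes sub: "\<And>T. subsemigroup (ideal_monoid H) T \<Longrightarrow> divisor_closed (ideal_monoid H) T \<Longrightarrow>
    T \<noteq> {carrier H} \<Longrightarrow> princ_ideals H \<subseteq> T"
  shows "strongly_Archimedean H"
proof (cases "carrier H - Units H = {}")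
  case True
  \<comment> \<open>In a group there is no product of \<open>Suc n\<close> non-units, so the
    condition is vacuous. The case is separate because the empty set is not an ideal.\<close>
  then show ?thesis
    unfolding strongly_Archimedean_iff True by simp
next
  case False
  let ?N = "carrier H - Units H"
  let ?T = "{I. monoid_ideal H I \<and> (\<exists>n. ?N [^]\<^bsub>ideal_monoid H\<^esub> (Suc n) \<subseteq> I)}"
  have N: "monoid_ideal H ?N"
    using False by (rule monoid_ideal_non_units)
  note T = divisor_closed_pow_superset[OF N]
  \<comment> \<open>\<open>\<one>\<close> is a unit, so \<open>?N\<close> is a proper ideal; as a
    member of \<open>?T\<close> it makes \<open>?T\<close> non-trivial.\<close>
  have "?N \<noteq> carrier H"
    using Units_one_closed one_closed by blast
  then have "?T \<noteq> {carrier H}"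
    using T(3) singletonD by metis
  then have "princ_ideals H \<subseteq> ?T"
    by (rule sub[OF T(1,2)])
  then have "\<exists>n. ?N [^]\<^bsub>ideal_monoid H\<^esub> (Suc n) \<subseteq> princ_ideal H a" if "a \<in> carrier H" for a
    using that unfolding princ_ideals_def image_subset_iff by simp
  then show ?thesis
    unfolding strongly_Archimedean_iff ideal_pow_eq_products[OF N] by simp
qed

end

theorem proposition17:
  fixes H :: "('a, 'b) monoid_scheme"
  assumes "duo_monoid H"
  shows "strongly_Archimedean H \<longleftrightarrow>
    (\<forall>T. subsemigroup (ideal_monoid H) T \<and> divisor_closed (ideal_monoid H) T
         \<and> T \<noteq> {\<one>\<^bsub>ideal_monoid H\<^esub>}
      \<longrightarrow> princ_ideals H \<subseteq> T)"
proof -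
  interpret duo_monoid H by fact
  show ?thesis
    using princ_ideals_subset_if_strongly_Archimedean strongly_Archimedean_if_princ_ideals_subset
    unfolding ideal_monoid_simps by blast
qed

end
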